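(* Let $G=(V,E)$ be a graph on $n$ vertices, let $w\in\mathbb{R}_+^V$, and let $k\in\{1,\dots,n\}$. Then $$\varphi_k(G,w)\leq\psi_k^f(\overline{G},w).$$
   Context: Graphs are finite and simple; $\overline{G}$ is the complement of $G$ and $A_G$ is the adjacency matrix of $G$. For $w\in\mathbb{R}_+^V$ and $k\in\{1,\dots,n\}$, $$\varphi_k(G,w)=\max\{\langle M,Y\rangle : M,Y\in\mathbb{S}^V_+,\ \operatorname{diag}(Y)=w,\ A_G\circ Y=0,\ \langle I,M\rangle=k,\ M\preceq I\},$$ where $\mathbb{S}^V_+$ is the set of positive semidefinite real symmetric $V\times V$ matrices, $I$ the identity, $\circ$ the entrywise product, $\langle A,B\rangle=\operatorname{trace}(AB)$, $\operatorname{diag}(Y)$ the vector of diagonal entries of $Y$, and $A\preceq B$ means $B-A$ is positive semidefinite. For a graph $H$ with vertex set $V(H)$ and $u\in\mathbb{R}_+^{V(H)}$, the weighted fractional chromatic number is $$\chi_f(H,u)=\min\Big\{\sum_{S\in\mathcal{S}(H)}y_S : y\in\mathbb{R}_+^{\mathcal{S}(H)},\ \sum_{S\in\mathcal{S}(H)}y_S\mathbf{1}_S=u\Big\},$$ where $\mathcal{S}(H)$ is the set of nonempty independent sets of $H$ and $\mathbf{1}_S$ is the incidence vector of $S$ (the value is $0$ if $V(H)=\emptyset$). For a graph $H$ with vertex set $V$, $w\in\mathbb{R}_+^V$ and a positive integer $k$, $$\psi_k^f(H,w)=\min_{S\subseteq V}\Big\{k\,\chi_f(H-S,\,w_{V\setminus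 S})+\sum_{i\in S}w_i\Big\},$$ where $H-S$ is the subgraph obtained by deleting the vertices in $S$ and $w_{V\setminus S}$ is the restriction of $w$ to $V\setminus S$. *)

theory Defs
  imports "HOL-Analysis.Analysis"
begin

section \<open>Finite simple graphs\<close>

record 'a ugraph =
  verts :: "'a set"
  edges :: "'a set set"

definition simple_graph :: "'a ugraph \<Rightarrow> bool" where
  "simple_graph G \<longleftrightarrow> finite (verts G) \<and> edges G \<subseteq> {e. e \<subseteq> verts G \<and> card e = 2}"

definition complement :: "'a ugraph \<Rightarrow> 'a ugraph" where
  "complement G = \<lparr>verts = verts G, edges = {e. e \<subseteq> verts G \<and> card e = 2} - edges G\<rparr>"

definition delete_verts :: "'a ugraph \<Rightarrow> 'a set \<Rightarrow> 'a ugraph" where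
  "delete_verts G S = \<lparr>verts = verts G - S, edges = {e \<in> edges G. e \<inter> S = {}}\<rparr>"

definition nonempty_indep_sets :: "'a ugraph \<Rightarrow> 'a set set" where
  "nonempty_indep_sets G =
     {S. S \<noteq> {} \<and> S \<subseteq> verts G \<and> (\<forall>u\<in>S. \<forall>v\<in>S. {u, v} \<notin> edges G)}"


section \<open>The semidefinite parameter\<close>

text \<open>Matrices are indexed by a finite type, so these notions are meant for graphs whose vertex
  set is the whole type.\<close>

definition adj_matrix :: "'n::finite ugraph \<Rightarrow> real^'n^'n" where
  "adj_matrix G = (\<chi> i j. if {i, j} \<in> edges G then 1 else 0)"

definition psd :: "real^'n^'n \<Rightarrow> bool" where
  "psd A \<longleftrightarrow> transpose A = A \<and> (\<forall>x. 0 \<le> x \<bullet> (A *v x))"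

definition loewner_le :: "real^'n^'n \<Rightarrow> real^'n^'n \<Rightarrow> bool"  (infix "\<preceq>\<^sub>L" 50) where
  "A \<preceq>\<^sub>L B \<longleftrightarrow> psd (B - A)"

definition entrywise_prod :: "real^'n^'n \<Rightarrow> real^'n^'n \<Rightarrow> real^'n^'n"  (infixl "\<circ>\<^sub>H" 70) where
  "A \<circ>\<^sub>H B = (\<chi> i j. A $ i $ j * B $ i $ j)"

definition mat_inner :: "real^'n^'n \<Rightarrow> real^'n^'n \<Rightarrow> real" where
  "mat_inner A B = trace (A ** B)"

definition phi_feasible ::
  "nat \<Rightarrow> 'n::finite ugraph \<Rightarrow> ('n \<Rightarrow> real) \<Rightarrow> ((real^'n^'n) \<times> (real^'n^'n)) set" where
  "phi_feasible k G w =
     {(M, Y). psd M \<and> psd Y \<and> (\<forall>i. Y $ i $ i = w i) \<and> adj_matrix G \<circ>\<^sub>H Y = 0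
        \<and> mat_inner (mat 1) M = real k \<and> M \<preceq>\<^sub>L mat 1}"

text \<open>The supremum is a maximum, see \<open>phi_attained\<close> below.\<close>

definition phi :: "nat \<Rightarrow> 'n::finite ugraph \<Rightarrow> ('n \<Rightarrow> real) \<Rightarrow> real" where
  "phi k G w = (SUP (M, Y) \<in> phi_feasible k G w. mat_inner M Y)"


section \<open>Fractional colouring parameters\<close>

definition frac_colourings :: "'a ugraph \<Rightarrow> ('a \<Rightarrow> real) \<Rightarrow> ('a set \<Rightarrow> real) set" where
  "frac_colourings H u =
     {y. (\<forall>S\<in>nonempty_indep_sets H. 0 \<le> y S)
       \<and> (\<forall>v\<in>verts H. (\<Sum>S\<in>nonempty_indep_sets H. y S * indicator S v) = u v)}"

text \<open>The infimum is a minimum, see \<open>chi_f_attained\<close> below. The value depends only on the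
  weights \<open>u v\<close> of vertices \<open>v\<close> of \<open>H\<close>, so in \<open>psi_f\<close> the weight function
  need not be restricted explicitly.\<close>

definition chi_f :: "'a ugraph \<Rightarrow> ('a \<Rightarrow> real) \<Rightarrow> real" where
  "chi_f H u = (INF y \<in> frac_colourings H u. \<Sum>S\<in>nonempty_indep_sets H. y S)"

definition psi_f :: "nat \<Rightarrow> 'a ugraph \<Rightarrow> ('a \<Rightarrow> real) \<Rightarrow> real" where
  "psi_f k H w = (MIN S \<in> Pow (verts H). real k * chi_f (delete_verts H S) w + (\<Sum>i\<in>S. w i))"


section \<open>The optima are attained\<close>

lemma quad_form_axis:
  fixes A :: "real^'n^'n"
  shows "(axis i 1 + s *\<^sub>R axis j 1) \<bullet> (A *v (axis i 1 + s *\<^sub>R axis j 1))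
     = A $ i $ i + s * A $ i $ j + s * A $ j $ i + s * s * A $ j $ j"
  by (simp add: matrix_vector_right_distrib matrix_vector_mult_scaleR inner_add_left
      inner_add_right inner_axis' matrix_vector_mul_component inner_axis algebra_simps)

lemma psd_entry_bound:
  fixes A :: "real^'n^'n"
  assumes "psd A" "\<And>i. A $ i $ i \<le> c"
  shows "\<bar>A $ i $ j\<bar> \<le> c"
proof -
  have s: "A $ j $ i = A $ i $ j"
    using assms(1) unfolding psd_def by (metis transpose_def vec_lambda_beta)
  have "0 \<le> A $ i $ i + s * A $ i $ j + s * A $ j $ i + s * s * A $ j $ j" for s
    using assms(1) unfolding psd_def by (metis quad_form_axis)
  from this[of 1] this[of "-1"] show ?thesis
    using s assms(2)[of i] assms(2)[of j] by auto
qed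

lemma psd_diag_nonneg:
  fixes A :: "real^'n^'n"
  assumes "psd A" shows "0 \<le> A $ i $ i"
  using assms quad_form_axis[of i 0 i A] unfolding psd_def by (metis add.right_neutral mult_zero_left)

lemma psd_norm_bound:
  fixes A :: "real^'n^'n"
  assumes "psd A" "\<And>i. A $ i $ i \<le> c"
  shows "norm A \<le> (\<Sum>i\<in>(UNIV::'n set). \<Sum>j\<in>(UNIV::'n set). c)"
proof -
  have "norm A \<le> (\<Sum>i\<in>UNIV. norm (A $ i))"
    by (simp add: norm_vec_def L2_set_le_sum)
  also have "\<dots> \<le> (\<Sum>i\<in>UNIV. \<Sum>j\<in>UNIV. norm (A $ i $ j))"
    by (intro sum_mono) (simp add: norm_vec_def L2_set_le_sum)
  also have "\<dots> \<le> (\<Sum>i\<in>(UNIV::'n set). \<Sum>j\<in>(UNIV::'n set). c)"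
    by (intro sum_mono) (simp add: psd_entry_bound[OF assms])
  finally show ?thesis .
qed

lemma compact_phi_feasible:
  fixes G :: "'n::finite ugraph"
  shows "compact (phi_feasible k G w)"
proof -
  have psd_eq: "psd A \<longleftrightarrow> (\<forall>i j. A $ j $ i = A $ i $ j) \<and>
      (\<forall>x. 0 \<le> (\<Sum>i\<in>UNIV. x $ i * (\<Sum>j\<in>UNIV. A $ i $ j * x $ j)))" for A :: "real^'n^'n"
    by (simp add: psd_def inner_vec_def matrix_vector_mult_def transpose_def vec_eq_iff)
  have "closed (phi_feasible k G w)"
    unfolding phi_feasible_def psd_eq loewner_le_def mat_inner_def trace_def matrix_matrix_mult_def
      entrywise_prod_def vec_eq_iff case_prod_unfold vec_lambda_beta vector_minus_component
    by (intro closed_Collect_conj closed_Collect_all closed_Collect_eq closed_Collect_le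
        continuous_intros)
  moreover have "bounded (phi_feasible k G w)"
  proof -
    let ?B = "\<lambda>c. \<Sum>i\<in>(UNIV::'n set). \<Sum>j\<in>(UNIV::'n set). c::real"
    have "M \<in> cball 0 (?B 1) \<and> Y \<in> cball 0 (?B (\<Sum>i\<in>UNIV. \<bar>w i\<bar>))"
      if "(M, Y) \<in> phi_feasible k G w" for M Y
    proof
      have "M $ i $ i \<le> 1" for i
        using that psd_diag_nonneg[of "mat 1 - M" i]
        by (auto simp: phi_feasible_def loewner_le_def mat_def)
      then show "M \<in> cball 0 (?B 1)"
        using that psd_norm_bound[of M 1] by (auto simp: phi_feasible_def)
      have "Y $ i $ i \<le> (\<Sum>i\<in>UNIV. \<bar>w i\<bar>)" for i
        using that member_le_sum[of i UNIV "\<lambda>i. \<bar>w i\<bar>"]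
        by (auto simp: phi_feasible_def intro: order_trans[OF abs_ge_self])
      then show "Y \<in> cball 0 (?B (\<Sum>i\<in>UNIV. \<bar>w i\<bar>))"
        using that psd_norm_bound[of Y "\<Sum>i\<in>UNIV. \<bar>w i\<bar>"] by (auto simp: phi_feasible_def)
    qed
    then have "phi_feasible k G w \<subseteq> cball 0 (?B 1) \<times> cball 0 (?B (\<Sum>i\<in>UNIV. \<bar>w i\<bar>))"
      by (metis (no_types, lifting) SigmaI subrelI)
    then show ?thesis
      by (rule bounded_subset[OF bounded_Times[OF bounded_cball bounded_cball]])
  qed
  ultimately show ?thesis
    by (simp add: compact_eq_bounded_closed)
qed

lemma psd_diagonal:
  fixes d :: "'n::finite \<Rightarrow> real"
  assumes "\<And>i. 0 \<le> d i"
  shows "psd (\<chi> i j. if i = j then d i else 0)"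
  unfolding psd_def
proof (intro conjI allI)
  show "transpose (\<chi> i j. if i = j then d i else 0) = (\<chi> i j. if i = j then d i else 0)"
    by (simp add: transpose_def vec_eq_iff)
  fix x :: "real^'n"
  have "x \<bullet> ((\<chi> i j. if i = j then d i else 0) *v x) = (\<Sum>i\<in>UNIV. d i * (x $ i * x $ i))"
    by (simp add: inner_vec_def matrix_vector_mult_def if_distrib if_distribR sum.delta
        mult_ac cong: if_cong)
  then show "0 \<le> x \<bullet> ((\<chi> i j. if i = j then d i else 0) *v x)"
    using assms by (simp add: sum_nonneg)
qed

lemma phi_feasible_nonempty:
  fixes G :: "'n::finite ugraph"
  assumes "simple_graph G" "\<And>i. 0 \<le> w i" "k \<le> CARD('n)"
  shows "phi_feasible k G w \<noteq> {}"
proof -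
  define c where "c = real k / real CARD('n)"
  have c: "0 \<le> c" "c \<le> 1"
    using assms(3) by (auto simp: c_def divide_simps)
  let ?D = "\<lambda>d. \<chi> i j. if i = j then d i else (0::real)"
  have 1: "{i} \<notin> edges G" for i
    using assms(1) unfolding simple_graph_def by fastforce
  have 2: "mat 1 - ?D (\<lambda>_. c) = ?D (\<lambda>_. 1 - c)"
    by (simp add: mat_def vec_eq_iff)
  have "(?D (\<lambda>_. c), ?D w) \<in> phi_feasible k G w"
    unfolding phi_feasible_def
    using psd_diagonal[of "\<lambda>_. c"] psd_diagonal[of w] psd_diagonal[of "\<lambda>_. 1 - c"] c assms(2) 1
    by (auto simp: loewner_le_def 2 mat_inner_def trace_def c_def entrywise_prod_def adj_matrix_def
        vec_eq_iff)
  then show ?thesis by blast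
qed

lemma phi_attained:
  fixes G :: "'n::finite ugraph"
  assumes "simple_graph G" "\<And>i. 0 \<le> w i" "k \<le> CARD('n)"
  shows "\<exists>(M, Y)\<in>phi_feasible k G w. phi k G w = mat_inner M Y
    \<and> (\<forall>(M', Y')\<in>phi_feasible k G w. mat_inner M' Y' \<le> mat_inner M Y)"
proof -
  have "continuous_on (phi_feasible k G w) (\<lambda>z. mat_inner (fst z) (snd z))"
    unfolding mat_inner_def trace_def matrix_matrix_mult_def vec_lambda_beta
    by (intro continuous_intros)
  moreover have ne: "phi_feasible k G w \<noteq> {}"
    by (intro phi_feasible_nonempty assms)
  ultimately obtain z where z: "z \<in> phi_feasible k G w"
    "\<And>z'. z' \<in> phi_feasible k G w \<Longrightarrow> mat_inner (fst z') (snd z') \<le> mat_inner (fst z) (snd z)"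
    using continuous_attains_sup[OF compact_phi_feasible ne] by blast
  have "phi k G w = mat_inner (fst z) (snd z)"
    unfolding phi_def case_prod_unfold by (intro cSup_eq_maximum) (use z in auto)
  then show ?thesis
    using z by (intro bexI[of _ z]) auto
qed

lemma finite_nonempty_indep_sets:
  "simple_graph H \<Longrightarrow> finite (nonempty_indep_sets H)"
  by (rule finite_subset[of _ "Pow (verts H)"]) (auto simp: nonempty_indep_sets_def simple_graph_def)

lemma frac_colourings_nonempty:
  assumes H: "simple_graph H" and u: "\<And>v. v \<in> verts H \<Longrightarrow> 0 \<le> u v"
  shows "frac_colourings H u \<noteq> {}"
proof -
  let ?I = "nonempty_indep_sets H"
  let ?y = "\<lambda>S. if is_singleton S then u (the_elem S) else 0"
  have single: "{v} \<in> ?I" if "v \<in> verts H" for v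
    using H that by (fastforce simp: nonempty_indep_sets_def simple_graph_def)
  have "(\<Sum>S\<in>?I. ?y S * indicator S v) = u v" if v: "v \<in> verts H" for v
  proof -
    have "(\<Sum>S\<in>?I. ?y S * indicator S v) = (\<Sum>S\<in>?I. if S = {v} then u v else 0)"
      by (intro sum.cong) (auto simp: is_singleton_def indicator_def)
    also have "\<dots> = u v"
      using single[OF v] finite_nonempty_indep_sets[OF H] by (simp add: sum.delta)
    finally show ?thesis .
  qed
  moreover have "0 \<le> ?y S" if "S \<in> ?I" for S
    using that u by (auto simp: is_singleton_def nonempty_indep_sets_def)
  ultimately have "?y \<in> frac_colourings H u"
    unfolding frac_colourings_def by blast
  then show ?thesis by blast
qed

lemma chi_f_attained:
  assumes H: "simple_graph H" and u: "\<And>v. v \<in> verts H \<Longrightarrow> 0 \<le> u v"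
  shows "\<exists>y\<in>frac_colourings H u. chi_f H u = (\<Sum>S\<in>nonempty_indep_sets H. y S)
    \<and> (\<forall>z\<in>frac_colourings H u.
         (\<Sum>S\<in>nonempty_indep_sets H. y S) \<le> (\<Sum>S\<in>nonempty_indep_sets H. z S))"
proof -
  let ?I = "nonempty_indep_sets H"
  let ?val = "\<lambda>y. \<Sum>S\<in>?I. y S"
  define trim where "trim y = (\<lambda>S. if S \<in> ?I then y S else 0)" for y :: "'a set \<Rightarrow> real"
  define F where "F = {y \<in> frac_colourings H u. \<forall>S. S \<notin> ?I \<longrightarrow> y S = 0}"
  have fin: "finite ?I" "finite (verts H)"
    using H finite_nonempty_indep_sets by (auto simp: simple_graph_def)
  have trim: "trim y \<in> F" "?val (trim y) = ?val y" if "y \<in> frac_colourings H u" for y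
    using that by (auto simp: F_def trim_def frac_colourings_def)
  have bound: "0 \<le> y S \<and> y S \<le> (\<Sum>v\<in>verts H. \<bar>u v\<bar>)" if y: "y \<in> F" for y S
  proof (cases "S \<in> ?I")
    case True
    then obtain v where v: "v \<in> S" "v \<in> verts H"
      by (auto simp: nonempty_indep_sets_def)
    have nonneg: "\<And>T. T \<in> ?I \<Longrightarrow> 0 \<le> y T"
      using y by (auto simp: F_def frac_colourings_def)
    have "y S * indicator S v \<le> (\<Sum>T\<in>?I. y T * indicator T v)"
      by (rule member_le_sum[of S ?I "\<lambda>T. y T * indicator T v"])
        (use True nonneg fin in auto)
    also have "\<dots> = u v"
      using y v by (auto simp: F_def frac_colourings_def)
    also have "\<dots> \<le> \<bar>u v\<bar>" by simp
    also have "\<dots> \<le> (\<Sum>v\<in>verts H. \<bar>u v\<bar>)"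
      using member_le_sum[of v "verts H" "\<lambda>v. \<bar>u v\<bar>"] v fin by auto
    finally show ?thesis
      using True nonneg v by simp
  next
    case False
    then show ?thesis
      using y by (simp add: F_def sum_nonneg)
  qed
  let ?box = "PiE UNIV (\<lambda>_::'a set. {0..\<Sum>v\<in>verts H. \<bar>u v\<bar>})"
  have "compact ?box"
    unfolding compactin_euclidean_iff[symmetric] euclidean_product_topology[symmetric]
    by (subst compactin_PiE) auto
  moreover have "closed F"
    unfolding F_def frac_colourings_def Ball_def mem_Collect_eq
    by (intro closed_Collect_conj closed_Collect_all closed_Collect_imp closed_Collect_eq
        closed_Collect_le continuous_intros continuous_on_product_coordinates open_Collect_const)
  ultimately have "compact (?box \<inter> F)"
    by (rule compact_Int_closed)
  moreover have "?box \<inter> F = F"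
    using bound by (auto simp: PiE_iff)
  ultimately have "compact F" by simp
  moreover have "F \<noteq> {}"
    using frac_colourings_nonempty[of H u, OF H u] trim(1) by blast
  moreover have "continuous_on F ?val"
    by (intro continuous_intros continuous_on_subset[OF continuous_on_product_coordinates]) auto
  ultimately obtain y where y: "y \<in> F" "\<And>z. z \<in> F \<Longrightarrow> ?val y \<le> ?val z"
    using continuous_attains_inf[of F ?val] by blast
  have yF: "y \<in> frac_colourings H u"
    using y by (simp add: F_def)
  have min: "?val y \<le> ?val z" if "z \<in> frac_colourings H u" for z
    using y(2)[OF trim(1)[OF that]] trim(2)[OF that] by simp
  have "chi_f H u = ?val y"
    unfolding chi_f_def by (intro cInf_eq_minimum) (use yF min in auto)
  then show ?thesis
    using yF min by blast
qed

end

theory Submission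
  imports Defs
begin

text \<open>
  Let \<open>(M, Y)\<close> be feasible and let \<open>R\<close> be the symmetric square root of \<open>Y\<close>, with columns \<open>p i\<close>.
  These columns are a Gram representation of \<open>Y\<close>, that is \<open>p i \<bullet> p j = Y $ i $ j\<close>; and because
  \<open>R\<close> is symmetric, \<open>Y\<close> is also the sum of the rank-one matrices of the \<open>p i\<close>, so that
  \<open>mat_inner M Y = (\<Sum>i\<in>UNIV. p i \<bullet> (M *v p i))\<close>.
  For a general factorization of \<open>Y\<close> the sum of the rank-one matrices of the Gram vectors only has
  the same nonzero spectrum as \<open>Y\<close>, and \<open>M\<close> would have to be replaced by another matrix.

  The two constraints on \<open>M\<close> now bound the terms in two ways. From \<open>M \<preceq>\<^sub>L mat 1\<close>, the term of a
  vertex \<open>i\<close> is at most \<open>p i \<bullet> p i = w i\<close>; this is used for the vertices in the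
  set \<open>S\<close> that \<open>psi_f\<close> deletes.
  For the others, consider an independent set \<open>C\<close> of the complement of \<open>G\<close>, i.e. a clique of \<open>G\<close>.
  Since \<open>Y\<close> vanishes on the edges of \<open>G\<close>, the vectors \<open>p i\<close> with \<open>i \<in> C\<close> are
  pairwise orthogonal, and Bessel's inequality bounds the sum over \<open>C\<close> of their Rayleigh quotients
  by the trace of \<open>M\<close>, which is \<open>k\<close> (lemma \<open>sum_rayleigh_quotients_le_trace\<close>). The term of \<open>i\<close> is \<open>w i\<close> times
  its Rayleigh quotient, and a fractional colouring \<open>y\<close> writes \<open>w i\<close> as the sum of the \<open>y C\<close> over
  the cliques \<open>C\<close> containing \<open>i\<close>. Interchanging the two sums, the vertices outside \<open>S\<close> contribute
  at most \<open>k\<close> times the total weight of \<open>y\<close>. An optimal \<open>y\<close> turns this weight into \<open>chi_f\<close>.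

  The square roots come from the spectral theorem for self-adjoint operators, which is proved by
  maximizing the quadratic form on the unit sphere and passing to the orthogonal complement.
\<close>

section \<open>The spectral theorem for self-adjoint operators\<close>

text \<open>The first step of the spectral theorem: a maximizer \<open>v\<close> of \<open>x \<bullet> f x\<close> on the unit sphere of
  an invariant subspace is an eigenvector, since the derivative of the form along every
  direction \<open>h\<close> orthogonal to \<open>v\<close> vanishes, in particular along the residual of the eigenvalue
  equation.\<close>

lemma self_adjoint_eigenvector_exists:
  fixes f :: "'a::euclidean_space \<Rightarrow> 'a"
  assumes lin: "linear f" and sa: "\<And>x y. x \<bullet> f y = f x \<bullet> y"
    and V: "subspace V" "\<And>x. x \<in> V \<Longrightarrow> f x \<in> V" "V \<noteq> {0}"
  obtains v where "v \<in> V" "norm v = 1" "f v = (v \<bullet> f v) *\<^sub>R v"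
proof -
  let ?K = "sphere 0 1 \<inter> V"
  obtain x0 where x0: "x0 \<in> V" "x0 \<noteq> 0"
    using V(1,3) subspace_0 by blast
  then have "(1 / norm x0) *\<^sub>R x0 \<in> ?K"
    using V(1) by (simp add: subspace_scale)
  then have ne: "?K \<noteq> {}" by blast
  have cont: "continuous_on ?K (\<lambda>x. x \<bullet> f x)"
    by (intro continuous_intros linear_continuous_on linear_conv_bounded_linear[THEN iffD1] lin)
  have comp: "compact ?K"
    using closed_subspace[OF V(1)] by (simp add: compact_Int_closed)
  obtain v where v: "v \<in> ?K" and vmax: "\<And>x. x \<in> ?K \<Longrightarrow> x \<bullet> f x \<le> v \<bullet> f v"
    using continuous_attains_sup[OF comp ne cont] by blast
  define l where "l = v \<bullet> f v"
  have vV: "v \<in> V" and nv: "v \<bullet> v = 1"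
    using v by (auto simp: norm_eq_1)
  have homogeneous_bound: "x \<bullet> f x \<le> l * (x \<bullet> x)" if "x \<in> V" for x
  proof (cases "x = 0")
    case False
    have "(1 / norm x) *\<^sub>R x \<in> ?K"
      using that False V(1) by (simp add: subspace_scale)
    from vmax[OF this] have "(x \<bullet> f x) / (norm x)\<^sup>2 \<le> l"
      by (simp add: l_def linear_cmul[OF lin] power2_eq_square)
    then show ?thesis
      using False by (simp add: divide_simps power2_norm_eq_inner)
  qed simp
  have stationary: "h \<bullet> f v = 0" if h: "h \<in> V" "v \<bullet> h = 0" for h
  proof -
    define b where "b = l * (h \<bullet> h) - h \<bullet> f h"
    have b: "0 \<le> b"
      using homogeneous_bound[OF h(1)] by (simp add: b_def)
    have quad: "2 * t * (h \<bullet> f v) \<le> t\<^sup>2 * b" for t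
    proof -
      have "v + t *\<^sub>R h \<in> V"
        using V(1) vV h by (simp add: subspace_add subspace_scale)
      then have "(v + t *\<^sub>R h) \<bullet> f (v + t *\<^sub>R h) \<le> l * ((v + t *\<^sub>R h) \<bullet> (v + t *\<^sub>R h))"
        by (rule homogeneous_bound)
      also have "(v + t *\<^sub>R h) \<bullet> (v + t *\<^sub>R h) = 1 + t\<^sup>2 * (h \<bullet> h)"
        using h(2) nv by (simp add: inner_add_left inner_add_right power2_eq_square inner_commute)
      also have "(v + t *\<^sub>R h) \<bullet> f (v + t *\<^sub>R h) = l + 2 * t * (h \<bullet> f v) + t\<^sup>2 * (h \<bullet> f h)"
        using sa[of v h]
        by (simp add: linear_add[OF lin] linear_cmul[OF lin] inner_add_left inner_add_right l_def
            power2_eq_square inner_commute algebra_simps)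
      finally show ?thesis
        by (simp add: b_def algebra_simps)
    qed
    \<comment> \<open>At \<open>t = c / (b + 1)\<close> the linear term dominates the quadratic one; the denominator is
      \<open>b + 1\<close> because \<open>b\<close> may be zero.\<close>
    define c where "c = h \<bullet> f v"
    have "2 * (c / (b + 1)) * c \<le> (c / (b + 1))\<^sup>2 * b"
      using quad[of "c / (b + 1)"] by (simp add: c_def)
    then have "2 * c\<^sup>2 * (b + 1) \<le> c\<^sup>2 * b"
      using b by (simp add: divide_simps power2_eq_square)
    then have "c\<^sup>2 * (b + 2) \<le> 0"
      by (simp add: algebra_simps)
    then have "c = 0"
      using b by (simp add: mult_le_0_iff)
    then show ?thesis by (simp add: c_def)
  qed
  define h where "h = f v - l *\<^sub>R v"
  have hV: "h \<in> V"
    using V vV by (simp add: h_def subspace_diff subspace_scale)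
  have hv: "v \<bullet> h = 0"
    using nv by (simp add: h_def inner_diff_right l_def)
  have "h \<bullet> h = h \<bullet> f v - l * (v \<bullet> h)"
    by (subst (2) h_def) (simp add: inner_diff_right inner_commute)
  then have "h = 0"
    using stationary[OF hV hv] hv by simp
  then show thesis
    using v that by (auto simp: h_def l_def)
qed

text \<open>The orthogonal complement of an eigenvector of a self-adjoint operator is again invariant, so
  one eigenvector after another can be split off. The statement is about an arbitrary invariant
  subspace to make this an induction on the dimension.\<close>

lemma self_adjoint_orthonormal_eigenbasis:
  fixes f :: "'a::euclidean_space \<Rightarrow> 'a"
  assumes lin: "linear f" and sa: "\<And>x y. x \<bullet> f y = f x \<bullet> y"
    and "subspace V" "\<And>x. x \<in> V \<Longrightarrow> f x \<in> V"
  shows "\<exists>B. pairwise orthogonal B \<and> (\<forall>b\<in>B. norm b = 1 \<and> f b = (b \<bullet> f b) *\<^sub>R b) \<and> span B = V"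
  using assms(3,4)
proof (induction "dim V" arbitrary: V rule: less_induct)
  case (less V)
  show ?case
  proof (cases "V = {0}")
    case True
    then show ?thesis
      by (intro exI[of _ "{}"]) (simp add: pairwise_def)
  next
    case False
    then obtain v where v: "v \<in> V" "norm v = 1" "f v = (v \<bullet> f v) *\<^sub>R v"
      using self_adjoint_eigenvector_exists[OF lin sa] less.prems by metis
    have vv: "v \<bullet> v = 1" using v by (simp add: norm_eq_1)
    define W where "W = V \<inter> {x. orthogonal v x}"
    have W: "subspace W"
      using less.prems(1) by (simp add: W_def subspace_inter subspace_orthogonal_to_vector)
    have inv: "f x \<in> W" if "x \<in> W" for x
    proof -
      have "v \<bullet> f x = (v \<bullet> f v) * (v \<bullet> x)"
        using sa[of v x] v(3) by (metis inner_scaleR_left)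
      then show ?thesis
        using that less.prems(2) by (simp add: W_def orthogonal_def)
    qed
    have "v \<notin> W"
      using vv by (simp add: W_def orthogonal_def)
    then have "dim W < dim V"
      using subspace_dim_equal[OF W less.prems(1)] v(1) by (force simp: W_def not_le)
    from less.hyps[OF this W inv] obtain B where B: "pairwise orthogonal B"
      "\<And>b. b \<in> B \<Longrightarrow> norm b = 1 \<and> f b = (b \<bullet> f b) *\<^sub>R b" "span B = W"
      by metis
    have BW: "B \<subseteq> W" using B(3) span_superset by blast
    have "pairwise orthogonal (insert v B)"
      using B(1) BW by (auto simp: pairwise_insert W_def orthogonal_commute)
    moreover have "span (insert v B) = V"
    proof
      show "span (insert v B) \<subseteq> V"
        using BW v(1) less.prems(1) by (intro span_minimal) (auto simp: W_def)
      show "V \<subseteq> span (insert v B)"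
      proof
        fix x assume "x \<in> V"
        then have "x - (v \<bullet> x) *\<^sub>R v \<in> span B"
          using v(1) vv less.prems(1)
          by (simp add: B(3) W_def orthogonal_def inner_diff_right subspace_diff subspace_scale)
        then show "x \<in> span (insert v B)"
          using span_breakdown_eq by blast
      qed
    qed
    ultimately show ?thesis
      using v B(2) by (intro exI[of _ "insert v B"]) auto
  qed
qed

section \<open>Square roots of positive semidefinite matrices\<close>

lemma symmetric_matrix_inner:
  fixes A :: "real^'n^'n"
  assumes "transpose A = A"
  shows "x \<bullet> (A *v y) = (A *v x) \<bullet> y"
  using assms by (metis dot_lmul_matrix vector_transpose_matrix)

text \<open>The root acts on an orthonormal eigenbasis of \<open>A\<close> by the square roots of the eigenvalues,
  which positive semidefiniteness makes nonnegative.\<close>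

lemma psd_square_root:
  fixes A :: "real^'n^'n"
  assumes "psd A"
  obtains R where "transpose R = R" "R ** R = A"
proof -
  have sym: "transpose A = A" and nonneg: "\<And>x. 0 \<le> x \<bullet> (A *v x)"
    using assms by (auto simp: psd_def)
  obtain B where B: "pairwise orthogonal B" "\<And>b. b \<in> B \<Longrightarrow> norm b = 1"
    "\<And>b. b \<in> B \<Longrightarrow> A *v b = (b \<bullet> (A *v b)) *\<^sub>R b" "span B = UNIV"
    using self_adjoint_orthonormal_eigenbasis[of "(*v) A" UNIV] symmetric_matrix_inner[OF sym]
    by auto
  have fin: "finite B"
    using B(1) pairwise_orthogonal_imp_finite by blast
  have expand: "(\<Sum>b\<in>B. (x \<bullet> b) *\<^sub>R b) = x" for x
    using orthonormal_basis_expand[OF B(1,2) _ fin] B(4) by auto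
  define s where "s b = sqrt (b \<bullet> (A *v b))" for b
  define r where "r x = (\<Sum>b\<in>B. (s b * (x \<bullet> b)) *\<^sub>R b)" for x
  have lin: "linear r"
    unfolding r_def
    by (intro linearI)
      (simp_all add: inner_add_left algebra_simps sum.distrib scaleR_sum_right)
  have coord: "r x \<bullet> b = s b * (x \<bullet> b)" if b: "b \<in> B" for x b
  proof -
    have "r x \<bullet> b = (\<Sum>c\<in>B. if c = b then s b * (x \<bullet> b) else 0)"
      unfolding r_def inner_sum_left
      using B(1,2) b
      by (intro sum.cong) (auto simp: pairwise_def orthogonal_def norm_eq_1)
    then show ?thesis using fin b by simp
  qed
  have sa: "x \<bullet> r y = r x \<bullet> y" for x y
    by (simp add: r_def inner_sum_left inner_sum_right inner_commute mult_ac)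
  have sq: "r (r x) = A *v x" for x
  proof -
    have "r (r x) = (\<Sum>b\<in>B. ((A *v x) \<bullet> b) *\<^sub>R b)"
      unfolding r_def[of "r x"]
    proof (intro sum.cong refl)
      fix b assume b: "b \<in> B"
      have "(A *v x) \<bullet> b = (b \<bullet> (A *v b)) * (x \<bullet> b)"
        using symmetric_matrix_inner[OF sym, of x b] B(3)[OF b] by (metis inner_scaleR_right)
      then show "(s b * (r x \<bullet> b)) *\<^sub>R b = ((A *v x) \<bullet> b) *\<^sub>R b"
        using nonneg[of b] by (simp add: coord[OF b] s_def flip: mult.assoc)
    qed
    then show ?thesis using expand by simp
  qed
  have works: "matrix r *v x = r x" for x
    using lin by (simp add: matrix_works linear_matrix_vector_mul_eq)
  show thesis
  proof
    show "transpose (matrix r) = matrix r"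
      using adjoint_unique[of r r] sa lin works
      by (metis adjoint_matrix matrix_adjoint)
    show "matrix r ** matrix r = A"
      by (simp add: matrix_eq works sq flip: matrix_vector_mul_assoc)
  qed
qed

section \<open>Rayleigh quotients of orthogonal vectors\<close>

lemma trace_eq_sum_axis:
  fixes A :: "real^'n^'n"
  shows "trace A = (\<Sum>i\<in>UNIV. axis i 1 \<bullet> (A *v axis i 1))"
  by (simp add: trace_def inner_axis' matrix_vector_mul_component inner_axis)

text \<open>Bessel's inequality for vectors that are not normalized. Zero vectors are allowed, and
  contribute nothing because \<open>0 / 0 = 0\<close>.\<close>

lemma bessel_inequality:
  fixes p :: "'i \<Rightarrow> 'a::real_inner"
  assumes fin: "finite C" and orth: "\<And>i j. i \<in> C \<Longrightarrow> j \<in> C \<Longrightarrow> i \<noteq> j \<Longrightarrow> p i \<bullet> p j = 0"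
  shows "(\<Sum>i\<in>C. (p i \<bullet> x)\<^sup>2 / (p i \<bullet> p i)) \<le> x \<bullet> x"
proof -
  define c where "c i = (p i \<bullet> x) / (p i \<bullet> p i)" for i
  let ?s = "\<Sum>i\<in>C. (p i \<bullet> x)\<^sup>2 / (p i \<bullet> p i)"
  define z where "z = (\<Sum>i\<in>C. c i *\<^sub>R p i)"
  have zx: "z \<bullet> x = ?s"
    by (simp add: z_def inner_sum_left c_def power2_eq_square)
  have "z \<bullet> z = (\<Sum>i\<in>C. c i * (p i \<bullet> z))"
    by (subst z_def) (simp add: inner_sum_left)
  also have "\<dots> = (\<Sum>i\<in>C. c i * (p i \<bullet> x))"
  proof (intro sum.cong refl)
    fix i assume i: "i \<in> C"
    have "p i \<bullet> z = (\<Sum>j\<in>C. if j = i then c i * (p i \<bullet> p i) else 0)"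
      unfolding z_def inner_sum_right using orth[OF i] by (intro sum.cong) auto
    also have "\<dots> = c i * (p i \<bullet> p i)"
      using fin i by simp
    also have "\<dots> = p i \<bullet> x"
      by (simp add: c_def)
    finally show "c i * (p i \<bullet> z) = c i * (p i \<bullet> x)" by simp
  qed
  finally have zz: "z \<bullet> z = ?s"
    by (simp add: c_def power2_eq_square)
  have "0 \<le> (x - z) \<bullet> (x - z)" by simp
  also have "\<dots> = x \<bullet> x - ?s"
    using zx zz by (simp add: inner_diff_left inner_diff_right inner_commute)
  finally show ?thesis by simp
qed

text \<open>For orthonormal vectors this says that compressing a positive semidefinite matrix to a
  subspace does not increase its trace. With \<open>N\<close> the square root of \<open>M\<close>, each quadratic form
  \<open>p i \<bullet> (M *v p i)\<close> is the sum of the squared inner products of \<open>p i\<close> with the columns of \<open>N\<close>,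
  and the trace is the sum of the squared norms of these columns, so that Bessel's inequality
  applies column by column.\<close>

lemma sum_rayleigh_quotients_le_trace:
  fixes M :: "real^'n^'n" and p :: "'i \<Rightarrow> real^'n"
  assumes "psd M" and fin: "finite C"
    and orth: "\<And>i j. i \<in> C \<Longrightarrow> j \<in> C \<Longrightarrow> i \<noteq> j \<Longrightarrow> p i \<bullet> p j = 0"
  shows "(\<Sum>i\<in>C. (p i \<bullet> (M *v p i)) / (p i \<bullet> p i)) \<le> trace M"
proof -
  obtain N where N: "transpose N = N" "N ** N = M"
    using psd_square_root[OF assms(1)] by blast
  have form: "x \<bullet> (M *v x) = (N *v x) \<bullet> (N *v x)" for x
    using symmetric_matrix_inner[OF N(1)] N(2) by (metis matrix_vector_mul_assoc)
  have columns: "x \<bullet> (M *v x) = (\<Sum>j\<in>UNIV. (x \<bullet> (N *v axis j 1))\<^sup>2)" for x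
  proof -
    have "(N *v x) $ j = x \<bullet> (N *v axis j 1)" for j
      using symmetric_matrix_inner[OF N(1), of x "axis j 1"] by (simp add: inner_axis)
    then show ?thesis
      unfolding form by (simp add: inner_vec_def power2_eq_square)
  qed
  have "(\<Sum>i\<in>C. (p i \<bullet> (M *v p i)) / (p i \<bullet> p i))
      = (\<Sum>j\<in>UNIV. \<Sum>i\<in>C. (p i \<bullet> (N *v axis j 1))\<^sup>2 / (p i \<bullet> p i))"
    unfolding columns sum_divide_distrib by (rule sum.swap)
  also have "\<dots> \<le> (\<Sum>j\<in>UNIV. (N *v axis j 1) \<bullet> (N *v axis j 1))"
    by (intro sum_mono bessel_inequality fin orth)
  also have "\<dots> = trace M"
    by (simp add: trace_eq_sum_axis form)
  finally show ?thesis .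
qed

section \<open>Bounding the semidefinite objective\<close>

lemma simple_graph_delete_complement:
  "simple_graph G \<Longrightarrow> simple_graph (delete_verts (complement G) S)"
  by (auto simp: simple_graph_def delete_verts_def complement_def)

lemma indep_set_of_complement_adjacent:
  assumes C: "C \<in> nonempty_indep_sets (delete_verts (complement G) S)"
    and ij: "i \<in> C" "j \<in> C" "i \<noteq> j"
  shows "{i, j} \<in> edges G"
proof -
  have "{i, j} \<notin> edges (delete_verts (complement G) S)" "{i, j} \<subseteq> verts G - S"
    using C ij by (auto simp: nonempty_indep_sets_def delete_verts_def complement_def)
  then show ?thesis
    using ij(3) by (auto simp: delete_verts_def complement_def)
qed

text \<open>A weak duality: each feasible point of the semidefinite program lies below the value of each
  pair of a deleted set \<open>S\<close> and a fractional colouring of the rest.\<close>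

lemma mat_inner_le_of_frac_colouring:
  fixes G :: "'n::finite ugraph"
  assumes G: "simple_graph G" "verts G = UNIV"
    and feas: "(M, Y) \<in> phi_feasible k G w"
    and y: "y \<in> frac_colourings (delete_verts (complement G) S) w"
  shows "mat_inner M Y
    \<le> real k * (\<Sum>C\<in>nonempty_indep_sets (delete_verts (complement G) S). y C) + (\<Sum>i\<in>S. w i)"
proof -
  let ?H = "delete_verts (complement G) S"
  let ?I = "nonempty_indep_sets ?H"
  have M: "psd M" "trace M = real k" "psd (mat 1 - M)"
    and Y: "psd Y" "\<And>i. Y $ i $ i = w i" "adj_matrix G \<circ>\<^sub>H Y = 0"
    using feas by (auto simp: phi_feasible_def mat_inner_def loewner_le_def)
  obtain R where R: "transpose R = R" "R ** R = Y"
    using psd_square_root[OF Y(1)] by blast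
  define p where "p i = R *v axis i 1" for i
  have gram: "p i \<bullet> p j = Y $ i $ j" for i j
  proof -
    have "p i \<bullet> p j = axis i 1 \<bullet> (Y *v axis j 1)"
      using symmetric_matrix_inner[OF R(1)] R(2) unfolding p_def by (metis matrix_vector_mul_assoc)
    then show ?thesis
      by (simp add: inner_axis' matrix_vector_mul_component inner_axis)
  qed
  have "mat_inner M Y = trace (R ** (M ** R))"
    unfolding mat_inner_def using R(2) by (metis matrix_mul_assoc trace_mul_sym)
  also have "\<dots> = (\<Sum>i\<in>UNIV. p i \<bullet> (M *v p i))"
    unfolding trace_eq_sum_axis p_def
    by (simp add: symmetric_matrix_inner[OF R(1)] flip: matrix_vector_mul_assoc)
  finally have objective: "mat_inner M Y = (\<Sum>i\<in>UNIV. p i \<bullet> (M *v p i))" .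
  define q where "q i = (p i \<bullet> (M *v p i)) / (p i \<bullet> p i)" for i
  \<comment> \<open>If \<open>w i = 0\<close>, then \<open>p i = 0\<close>, and both sides vanish.\<close>
  have weighted: "p i \<bullet> (M *v p i) = w i * q i" for i
  proof -
    have "p i \<bullet> (M *v p i) = (p i \<bullet> p i) * q i"
      by (simp add: q_def)
    then show ?thesis by (simp add: gram Y(2))
  qed
  have clique: "(\<Sum>i\<in>C. q i) \<le> real k" if C: "C \<in> ?I" for C
    unfolding q_def M(2)[symmetric]
  proof (rule sum_rayleigh_quotients_le_trace[OF M(1)])
    fix i j assume "i \<in> C" "j \<in> C" "i \<noteq> j"
    then have "{i, j} \<in> edges G"
      using indep_set_of_complement_adjacent[OF C] by blast
    then show "p i \<bullet> p j = 0"
      using Y(3) unfolding gram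
      by (simp add: vec_eq_iff entrywise_prod_def adj_matrix_def) (metis one_neq_zero)
  qed simp
  have kept: "(\<Sum>i\<in>-S. p i \<bullet> (M *v p i)) \<le> real k * (\<Sum>C\<in>?I. y C)"
  proof -
    have "(\<Sum>i\<in>-S. p i \<bullet> (M *v p i)) = (\<Sum>i\<in>-S. (\<Sum>C\<in>?I. y C * indicator C i) * q i)"
      using y G(2) unfolding weighted
      by (intro sum.cong) (auto simp: frac_colourings_def delete_verts_def complement_def)
    also have "\<dots> = (\<Sum>C\<in>?I. \<Sum>i\<in>-S. y C * indicator C i * q i)"
      unfolding sum_distrib_right by (rule sum.swap)
    also have "\<dots> = (\<Sum>C\<in>?I. y C * (\<Sum>i\<in>C. q i))"
    proof (intro sum.cong refl)
      fix C assume "C \<in> ?I"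
      then have "C \<subseteq> -S"
        by (auto simp: nonempty_indep_sets_def delete_verts_def)
      then have "(\<Sum>i\<in>C. q i) = (\<Sum>i\<in>-S. indicator C i * q i)"
        by (intro sum.mono_neutral_cong_left) auto
      then show "(\<Sum>i\<in>-S. y C * indicator C i * q i) = y C * (\<Sum>i\<in>C. q i)"
        by (simp only: sum_distrib_left mult.assoc)
    qed
    also have "\<dots> \<le> (\<Sum>C\<in>?I. y C * real k)"
      using y clique by (intro sum_mono mult_left_mono) (auto simp: frac_colourings_def)
    finally show ?thesis
      by (simp add: sum_distrib_left mult.commute)
  qed
  have deleted: "(\<Sum>i\<in>S. p i \<bullet> (M *v p i)) \<le> (\<Sum>i\<in>S. w i)"
  proof (intro sum_mono)
    fix i
    have "0 \<le> p i \<bullet> ((mat 1 - M) *v p i)"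
      using M(3) by (simp add: psd_def)
    then show "p i \<bullet> (M *v p i) \<le> w i"
      by (simp add: matrix_vector_mult_diff_rdistrib inner_diff_right gram Y(2))
  qed
  have "mat_inner M Y = (\<Sum>i\<in>-S. p i \<bullet> (M *v p i)) + (\<Sum>i\<in>S. p i \<bullet> (M *v p i))"
    unfolding objective by (subst sum.union_disjoint[symmetric]) auto
  with kept deleted show ?thesis by linarith
qed

theorem theorem17:
  fixes G :: "'n::finite ugraph" and w :: "'n \<Rightarrow> real" and k :: nat
  assumes "simple_graph G"
    and "verts G = UNIV"
    and "\<And>i. 0 \<le> w i"
    and "k \<in> {1..CARD('n)}"
  shows "phi k G w \<le> psi_f k (complement G) w"
proof -
  have bound: "phi k G w \<le> real k * chi_f (delete_verts (complement G) S) w + (\<Sum>i\<in>S. w i)" for S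
  proof -
    obtain y where y: "y \<in> frac_colourings (delete_verts (complement G) S) w"
      "chi_f (delete_verts (complement G) S) w
        = (\<Sum>C\<in>nonempty_indep_sets (delete_verts (complement G) S). y C)"
      using chi_f_attained[OF simple_graph_delete_complement[OF assms(1)]] assms(3) by metis
    have "phi_feasible k G w \<noteq> {}"
      using phi_feasible_nonempty assms by auto
    then show ?thesis
      unfolding phi_def y(2)
      by (rule cSUP_least) (auto intro: mat_inner_le_of_frac_colouring[OF assms(1,2) _ y(1)])
  qed
  have "finite (Pow (verts (complement G)))" by simp
  then show ?thesis
    unfolding psi_f_def using bound by (subst Min_ge_iff) auto
qed

end
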